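(* Let $\mathbb{A}=\mathbb{F}_q[T]$ and let $H\in\mathbb{A}$ be a nonzero polynomial. Then for every positive integer $k$, $$\varphi_k(H)= \varphi(H)^k \prod_{P \mid H} \left(1-\frac{1}{|P|-1}+\frac{1}{(|P|-1)^2}-\cdots+ (-1)^{k-1}\frac{1}{(|P|-1)^{k-1}}\right),$$ where the product runs over the monic irreducible polynomials $P$ dividing $H$.
   Context: $\mathbb{F}_q$ is a finite field with $q$ elements ($q$ a power of a prime $p$) and $\mathbb{A}=\mathbb{F}_q[T]$. For nonzero $A\in\mathbb{A}$, $|A|=q^{\deg A}$. For $A_1,\dots,A_k\in\mathbb{A}$, $(A_1,\dots,A_k)$ denotes their monic greatest common divisor. The Euler function is $\varphi(H)=|H|\prod_{P\mid H}(1-1/|P|)$ (product over monic irreducible $P$ dividing $H$); it equals the number of residue classes modulo $H$ coprime to $H$. For a positive integer $k$, the $k$-dimensional generalized Euler function is $$\varphi_k(H)=\#\{(H_1,\dots,H_k)\in(\mathbb{A}/H\mathbb{A})^k : (H_1\cdots H_k,H)=1,\ (H_1+\cdots+H_k,H)=1\},$$ i.e. the number of $k$-tuples of residue classes modulo $H$ satisfying these two coprimality conditions. *)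

theory Defs
  imports Complex_Main "HOL-Library.FuncSet" "HOL-Library.Cardinality" "HOL-Computational_Algebra.Polynomial"
    "HOL-Number_Theory.Cong"
begin

definition poly_abs :: "'a::{finite,field} poly \<Rightarrow> real" where
  "poly_abs A = (if A = 0 then 0 else real CARD('a) ^ degree A)"

definition monic_prime_divisors :: "'a::{finite,field} poly \<Rightarrow> 'a poly set" where
  "monic_prime_divisors H = {P. lead_coeff P = 1 \<and> irreducible P \<and> P dvd H}"

definition euler_phi :: "'a::{finite,field} poly \<Rightarrow> real" where
  "euler_phi H = poly_abs H * (\<Prod>P\<in>monic_prime_divisors H. 1 - 1 / poly_abs P)"

definition residue_classes :: "'a::{finite,field} poly \<Rightarrow> 'a poly set set" where
  "residue_classes H = UNIV // {(A, B). [A = B] (mod H)}"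

text \<open>A \<open>k\<close>-tuple of residue classes is an extensional function on \<open>{1..k}\<close>. The two
  coprimality conditions are stated for representatives \<open>A 1, \<dots>, A k\<close> of the classes; the lemma
  \<open>generalized_phi_representatives\<close> below shows that they do not depend on the choice of
  representatives. \<open>coprime\<close> says that the common divisors are the units, i.e. that the monic
  greatest common divisor is 1.\<close>

definition generalized_phi :: "nat \<Rightarrow> 'a::{finite,field} poly \<Rightarrow> nat" where
  "generalized_phi k H = card {C \<in> {1..k} \<rightarrow>\<^sub>E residue_classes H.
     \<exists>A. (\<forall>i\<in>{1..k}. A i \<in> C i) \<and> coprime (\<Prod>i=1..k. A i) H \<and> coprime (\<Sum>i=1..k. A i) H}"

lemma coprime_cong_poly:
  fixes A B H :: "'a::{finite,field} poly"
  assumes "[A = B] (mod H)" and "coprime A H"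
  shows "coprime B H"
proof (rule coprimeI)
  fix D assume D: "D dvd B" "D dvd H"
  have "H dvd A - B" using assms(1) by (simp add: cong_iff_dvd_diff)
  with D have "D dvd (A - B) + B" by (meson dvd_add dvd_trans)
  with D assms(2) show "is_unit D" by (auto intro: coprime_common_divisor)
qed

lemma generalized_phi_representatives:
  fixes A B :: "nat \<Rightarrow> 'a::{finite,field} poly"
  assumes C: "C \<in> {1..k} \<rightarrow>\<^sub>E residue_classes H"
    and A: "\<forall>i\<in>{1..k}. A i \<in> C i" and B: "\<forall>i\<in>{1..k}. B i \<in> C i"
  shows "coprime (\<Prod>i=1..k. A i) H \<longleftrightarrow> coprime (\<Prod>i=1..k. B i) H"
    and "coprime (\<Sum>i=1..k. A i) H \<longleftrightarrow> coprime (\<Sum>i=1..k. B i) H"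
proof -
  have AB: "[A i = B i] (mod H)" if "i \<in> {1..k}" for i
  proof -
    have "C i \<in> residue_classes H" using C that by (rule PiE_mem)
    then obtain R where "C i = {X. [R = X] (mod H)}"
      by (auto simp: residue_classes_def quotient_def)
    with A B that have "[R = A i] (mod H)" "[R = B i] (mod H)" by blast+
    then show ?thesis by (meson cong_trans cong_sym)
  qed
  have "[(\<Prod>i=1..k. A i) = (\<Prod>i=1..k. B i)] (mod H)" "[(\<Sum>i=1..k. A i) = (\<Sum>i=1..k. B i)] (mod H)"
    using AB by (auto intro!: cong_prod cong_sum)
  then show "coprime (\<Prod>i=1..k. A i) H \<longleftrightarrow> coprime (\<Prod>i=1..k. B i) H"
    "coprime (\<Sum>i=1..k. A i) H \<longleftrightarrow> coprime (\<Sum>i=1..k. B i) H"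
    by (blast intro: coprime_cong_poly cong_sym)+
qed

end

theory Submission
  imports Defs "HOL-Computational_Algebra.Polynomial_Factorial"
begin

text \<open>Build \<open>H\<close> up one monic irreducible factor at a time. Division with remainder writes every
  residue modulo \<open>P * H\<close> uniquely as \<open>B + H * C\<close> with \<open>B\<close> reduced modulo \<open>H\<close> and \<open>C\<close> reduced
  modulo \<open>P\<close>; the conditions at the primes dividing \<open>H\<close> only involve \<open>B\<close>. If \<open>P\<close> divides \<open>H\<close>,
  then \<open>C\<close> is unconstrained; otherwise, for fixed \<open>B\<close>, the map \<open>C \<mapsto> B + H * C\<close> permutes the
  residues modulo \<open>P\<close>, so the number of admissible \<open>C\<close> is the count \<open>a\<^sub>k\<close> for the prime modulus
  \<open>P\<close>. For the latter, a \<open>(k+1)\<close>-tuple of nonzero residues with sum zero is determined by its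
  first \<open>k\<close> entries, whose sum must be nonzero; hence \<open>a\<^bsub>k+1\<^esub> = (|P| - 1)\<^bsup>k+1\<^esup> - a\<^sub>k\<close>.\<close>

section \<open>Reduced residues and division with remainder\<close>

text \<open>Vanishing coefficients, rather than \<open>degree A < degree H\<close>, keep 0 in the
  set even for constant \<open>H\<close>, where the strict degree bound would leave nothing.\<close>

definition reduced :: "'a::{finite,field} poly \<Rightarrow> 'a poly set" where
  "reduced H = {A. \<forall>i\<ge>degree H. coeff A i = 0}"

text \<open>Splitting off the constant coefficient with \<open>pCons\<close> leaves one free element
  of the field and a polynomial with one coefficient fewer, so each step multiplies the count by
  \<open>CARD('a)\<close>.\<close>

lemma card_coeff_zero_from:
  "finite {A :: 'a::{finite,field} poly. \<forall>i\<ge>n. coeff A i = 0} \<and>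
   card {A :: 'a poly. \<forall>i\<ge>n. coeff A i = 0} = CARD('a) ^ n"
proof (induction n)
  case 0
  have "{A :: 'a poly. \<forall>i\<ge>0. coeff A i = 0} = {0}"
    by (auto simp: poly_eq_iff)
  then show ?case by simp
next
  case (Suc n)
  let ?S = "\<lambda>n. {A :: 'a poly. \<forall>i\<ge>n. coeff A i = 0}"
  have "A \<in> (\<lambda>(a, B). pCons a B) ` (UNIV \<times> ?S n)" if "A \<in> ?S (Suc n)" for A
  proof (cases A)
    case (pCons a B)
    then have "coeff B i = 0" if "i \<ge> n" for i
      using \<open>A \<in> ?S (Suc n)\<close> that by (auto dest: spec[of _ "Suc i"])
    then show ?thesis using pCons by auto
  qed
  then have eq: "?S (Suc n) = (\<lambda>(a, B). pCons a B) ` (UNIV \<times> ?S n)"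
    by (auto simp: coeff_pCons split: nat.splits)
  have "inj_on (\<lambda>(a, B). pCons a B) (UNIV \<times> ?S n)"
    by (auto simp: inj_on_def)
  then show ?case unfolding eq using Suc
    by (simp add: card_image card_cartesian_product)
qed

lemma finite_reduced [simp]: "finite (reduced H)"
  unfolding reduced_def using card_coeff_zero_from by blast

lemma card_reduced: "H \<noteq> 0 \<Longrightarrow> real (card (reduced H)) = poly_abs H"
  for H :: "'a::{finite,field} poly"
  unfolding reduced_def poly_abs_def
  using card_coeff_zero_from[of "degree H", where 'a = 'a] by simp

lemma zero_in_reduced [simp]: "0 \<in> reduced H"
  by (simp add: reduced_def)

lemma reduced_mod_eq: "A \<in> reduced H \<Longrightarrow> A mod H = A"
  by (cases "A = 0") (auto simp: reduced_def intro!: mod_poly_less, meson leI leading_coeff_0_iff)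

lemma mod_in_reduced: "H \<noteq> 0 \<Longrightarrow> A mod H \<in> reduced H"
  using degree_mod_less[of H A] by (auto simp: reduced_def coeff_eq_0)

lemma reduced_cong_imp_eq:
  assumes "A \<in> reduced H" "B \<in> reduced H" "H dvd A - B"
  shows "A = B"
  using assms by (metis mod_eq_dvd_iff reduced_mod_eq)

lemma reduced_dvd_iff: "A \<in> reduced H \<Longrightarrow> H dvd A \<longleftrightarrow> A = 0"
  using reduced_cong_imp_eq[of A H 0] by auto

lemma add_mult_in_reduced:
  assumes "B \<in> reduced H" "C \<in> reduced P" "H \<noteq> 0" "P \<noteq> 0"
  shows "B + H * C \<in> reduced (P * H)"
\<comment> \<open>The zero polynomial has \<open>degree\<close> 0, so the strict bound
  \<open>degree C < degree P\<close> would fail for it when \<open>P\<close> is constant.\<close>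
proof (cases "C = 0")
  case True
  then show ?thesis using assms by (auto simp: reduced_def degree_mult_eq)
next
  case False
  then have "degree C < degree P"
    using assms(2) by (auto simp: reduced_def) (meson leI leading_coeff_0_iff)
  then have "degree (H * C) < degree (P * H)"
    using assms False by (simp add: degree_mult_eq)
  then show ?thesis using assms
    by (auto simp: reduced_def degree_mult_eq coeff_eq_0)
qed

section \<open>Monic irreducible divisors\<close>

text \<open>Descent on the degree: a reducible non-unit splits into two non-units, both of positive
  degree over a field, so a factor has smaller degree. An irreducible polynomial is made monic by a
  scalar.\<close>

lemma exists_monic_irreducible_divisor:
  fixes D :: "'a::field poly"
  assumes "D \<noteq> 0" "\<not> is_unit D"
  shows "\<exists>P. lead_coeff P = 1 \<and> irreducible P \<and> P dvd D"
  using assms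
proof (induction "degree D" arbitrary: D rule: less_induct)
  case less
  show ?case
  proof (cases "irreducible D")
    case True
    let ?c = "inverse (lead_coeff D)"
    have c: "?c \<noteq> 0" using less by simp
    have "is_unit [:?c:]" using c by (simp add: is_unit_const_poly_iff dvd_field_iff)
    then have "irreducible ([:?c:] * D)" using True irreducible_mult_unit_left by blast
    then have "irreducible (smult ?c D)" by simp
    moreover have "smult ?c D dvd D" using c by (simp add: smult_dvd_iff)
    ultimately show ?thesis using less by (intro exI[of _ "smult ?c D"]) auto
  next
    case False
    then obtain A B where AB: "D = A * B" "\<not> is_unit A" "\<not> is_unit B"
      using less by (auto simp: irreducible_def)
    then have "degree B > 0" "A \<noteq> 0" "B \<noteq> 0"
      using less.prems is_unit_iff_degree by auto
    then have "degree A < degree D" using AB by (simp add: degree_mult_eq)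
    with less.hyps AB \<open>A \<noteq> 0\<close> show ?thesis by (meson dvd_mult2)
  qed
qed

text \<open>The cofactor is a unit, hence a constant, and comparing leading coefficients makes it
  1.\<close>

lemma monic_dvd_irreducible_imp_eq:
  fixes P Q :: "'a::field poly"
  assumes "lead_coeff P = 1" "irreducible P" "lead_coeff Q = 1" "irreducible Q" "Q dvd P"
  shows "Q = P"
proof -
  obtain R where R: "P = Q * R" using assms by auto
  then have "is_unit R" using assms by (auto simp: irreducible_def)
  then obtain c where "R = [:c:]" by (auto simp: is_unit_poly_iff)
  then have "lead_coeff P = lead_coeff Q * c" using R by (simp only: lead_coeff_mult) simp
  then have "c = 1" using assms by simp
  then show ?thesis using R \<open>R = [:c:]\<close> by simp
qed

lemma monic_prime_divisors_unit: "is_unit H \<Longrightarrow> monic_prime_divisors H = {}"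
  by (auto simp: monic_prime_divisors_def irreducible_def dest: dvd_unit_imp_unit)

text \<open>Irreducible polynomials over a field are prime, so a prime divisor of the product
  divides one of the factors. The form with \<open>insert\<close> covers a repeated \<open>P\<close>
  as well as a new one.\<close>

lemma monic_prime_divisors_mult:
  assumes "lead_coeff P = 1" "irreducible P"
  shows "monic_prime_divisors (P * H) = insert P (monic_prime_divisors H)"
proof -
  have "Q dvd P * H \<longleftrightarrow> Q = P \<or> Q dvd H" if "lead_coeff Q = 1" "irreducible Q" for Q
    using that assms prime_elem_dvd_mult_iff[OF field_poly_irreducible_imp_prime, of Q P H]
      monic_dvd_irreducible_imp_eq[of P Q] by auto
  then show ?thesis using assms by (auto simp: monic_prime_divisors_def)
qed

lemma poly_abs_mult: "poly_abs (A * B) = poly_abs A * poly_abs B"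
  by (auto simp: poly_abs_def degree_mult_eq power_add)

lemma poly_abs_irreducible_gt_1:
  fixes P :: "'a::{finite,field} poly"
  assumes "irreducible P"
  shows "poly_abs P > 1"
proof -
  have "P \<noteq> 0" "degree P > 0"
    using assms is_unit_iff_degree[of P] by (auto simp: irreducible_def)
  moreover have "CARD('a) > 1"
    using card_mono[of UNIV "{0, 1 :: 'a}"] by simp
  ultimately show ?thesis by (simp add: poly_abs_def one_less_power)
qed

text \<open>Strong induction on the degree, splitting off one monic irreducible divisor. In
  \<open>mult\<close> the factor \<open>P\<close> may already divide \<open>H\<close>, so uses of
  the rule have to treat repeated factors too.\<close>

lemma poly_divisor_induct [consumes 1, case_names unit mult]:
  fixes H :: "'a::field poly"
  assumes "H \<noteq> 0"
    and unit: "\<And>H. is_unit H \<Longrightarrow> R H"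
    and mult: "\<And>P H. \<lbrakk>lead_coeff P = 1; irreducible P; H \<noteq> 0; R H\<rbrakk> \<Longrightarrow> R (P * H)"
  shows "R H"
  using \<open>H \<noteq> 0\<close>
proof (induction "degree H" arbitrary: H rule: less_induct)
  case less
  show ?case
  proof (cases "is_unit H")
    case False
    then obtain P G where P: "lead_coeff P = 1" "irreducible P" "H = P * G"
      using exists_monic_irreducible_divisor[of H] less.prems by (auto elim!: dvdE)
    then have "degree P > 0" "P \<noteq> 0" "G \<noteq> 0"
      using less.prems is_unit_iff_degree[of P] by (auto simp: irreducible_def)
    then have "R G" using P by (intro less.hyps) (auto simp: degree_mult_eq)
    then show ?thesis using mult P \<open>G \<noteq> 0\<close> by blast
  qed (rule unit)
qed

lemma finite_monic_prime_divisors: "H \<noteq> 0 \<Longrightarrow> finite (monic_prime_divisors H)"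
  by (induction H rule: poly_divisor_induct)
    (simp_all add: monic_prime_divisors_unit monic_prime_divisors_mult)

text \<open>This makes the count local: coprimality becomes one condition for each prime divisor of
  \<open>H\<close>. A common divisor that is not a unit is nonzero because \<open>H\<close> is, and
  so has a monic irreducible divisor.\<close>

lemma coprime_iff_monic_prime_divisors:
  assumes "H \<noteq> 0"
  shows "coprime A H \<longleftrightarrow> (\<forall>P\<in>monic_prime_divisors H. \<not> P dvd A)"
proof
  assume "coprime A H"
  then show "\<forall>P\<in>monic_prime_divisors H. \<not> P dvd A"
    by (auto simp: monic_prime_divisors_def irreducible_def dest: coprime_common_divisor)
next
  assume *: "\<forall>P\<in>monic_prime_divisors H. \<not> P dvd A"
  show "coprime A H"
  proof (rule coprimeI, rule ccontr)
    fix D assume D: "D dvd A" "D dvd H" "\<not> is_unit D"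
    then have "D \<noteq> 0" using assms by auto
    then obtain P where "lead_coeff P = 1" "irreducible P" "P dvd D"
      using exists_monic_irreducible_divisor[of D] D by auto
    with D * show False by (auto simp: monic_prime_divisors_def intro: dvd_trans)
  qed
qed

section \<open>Counting tuples modulo one prime\<close>

text \<open>For irreducible \<open>P\<close> these are the two coprimality conditions read at
  \<open>P\<close> alone. A general index set allows induction by inserting one index.\<close>

definition admissible :: "nat set \<Rightarrow> 'a::{finite,field} poly \<Rightarrow> (nat \<Rightarrow> 'a poly) \<Rightarrow> bool" where
  "admissible I P A \<longleftrightarrow> (\<forall>i\<in>I. \<not> P dvd A i) \<and> \<not> P dvd (\<Sum>i\<in>I. A i)"

lemma admissible_cong:
  assumes "\<And>i. i \<in> I \<Longrightarrow> [A i = B i] (mod P)"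
  shows "admissible I P A \<longleftrightarrow> admissible I P B"
proof -
  have "[(\<Sum>i\<in>I. A i) = (\<Sum>i\<in>I. B i)] (mod P)"
    using assms by (rule cong_sum)
  then have "P dvd (\<Sum>i\<in>I. A i) \<longleftrightarrow> P dvd (\<Sum>i\<in>I. B i)" by (rule cong_dvd_iff)
  moreover have "P dvd A i \<longleftrightarrow> P dvd B i" if "i \<in> I" for i
    using assms[OF that] by (rule cong_dvd_iff)
  ultimately show ?thesis by (simp add: admissible_def)
qed

text \<open>Tuples of nonzero residues on \<open>insert i I\<close> split according to whether
  \<open>P\<close> divides their total. Deleting the entry at \<open>i\<close> matches those with
  divisible total with the admissible tuples on \<open>I\<close>. The subtraction of 1 is exact
  since 0 is a reduced residue.\<close>

lemma card_admissible_insert: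
  assumes "P \<noteq> 0" "finite I" "i \<notin> I"
  shows "card {C \<in> insert i I \<rightarrow>\<^sub>E reduced P. admissible (insert i I) P C} +
    card {C \<in> I \<rightarrow>\<^sub>E reduced P. admissible I P C} = (card (reduced P) - 1) ^ Suc (card I)"
proof -
  let ?J = "insert i I"
  define U where "U = ?J \<rightarrow>\<^sub>E (reduced P - {0})"
  define X where "X = {C \<in> ?J \<rightarrow>\<^sub>E reduced P. admissible ?J P C}"
  define Y where "Y = {C \<in> I \<rightarrow>\<^sub>E reduced P. admissible I P C}"
  define Z where "Z = {C \<in> U. P dvd (\<Sum>j\<in>?J. C j)}"
  have U: "C \<in> U \<longleftrightarrow> C \<in> ?J \<rightarrow>\<^sub>E reduced P \<and> (\<forall>j\<in>?J. \<not> P dvd C j)" for C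
    by (auto simp: U_def PiE_iff reduced_dvd_iff)
  have "U = X \<union> Z" "X \<inter> Z = {}"
    by (auto simp: X_def Z_def U admissible_def)
  moreover have "finite U" using assms by (simp add: U_def finite_PiE)
  ultimately have "card X + card Z = card U"
    by (metis card_Un_disjoint finite_Un)
  moreover have "card U = (card (reduced P) - 1) ^ Suc (card I)"
    using assms by (simp add: U_def card_PiE)
  \<comment> \<open>If the total is divisible by \<open>P\<close>, the entry at \<open>i\<close> is minus the sum of the others.\<close>
  moreover have "card Y = card Z"
  proof -
    let ?f = "\<lambda>C. C(i := (- (\<Sum>j\<in>I. C j)) mod P)"
    let ?g = "\<lambda>C. restrict C I"
    have sum_upd: "(\<Sum>j\<in>I. (C(i := x)) j) = (\<Sum>j\<in>I. C j)" for C :: "nat \<Rightarrow> 'a poly" and x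
      using assms by (intro sum.cong) auto
    have "\<forall>C\<in>Y. ?g (?f C) = C"
      using assms by (auto simp: Y_def fun_eq_iff PiE_iff extensional_def)
    moreover have "\<forall>C\<in>Z. ?f (?g C) = C"
    proof
      fix C assume C: "C \<in> Z"
      then have "P dvd (- (\<Sum>j\<in>I. C j)) - C i"
        using assms by (simp add: Z_def) (metis dvd_minus_iff minus_add_distrib uminus_add_conv_diff)
      then have "(- (\<Sum>j\<in>I. C j)) mod P = C i mod P"
        by (simp only: mod_eq_dvd_iff)
      also have "\<dots> = C i" using C by (intro reduced_mod_eq) (auto simp: Z_def U PiE_iff)
      finally show "?f (?g C) = C"
        using C assms by (auto simp: fun_eq_iff Z_def U PiE_iff extensional_def)
    qed
    moreover have "?f ` Y \<subseteq> Z"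
    proof
      fix D assume "D \<in> ?f ` Y"
      then obtain C where C: "C \<in> Y" "D = ?f C" by auto
      then have "D \<in> ?J \<rightarrow>\<^sub>E reduced P"
        using assms by (auto simp: Y_def PiE_iff extensional_def mod_in_reduced
            simp del: poly_mod_minus_left)
      moreover have "P dvd (\<Sum>j\<in>?J. D j)"
        using assms by (simp add: C(2) sum_upd dvd_eq_mod_eq_0 mod_add_left_eq fun_upd_same
            del: poly_mod_minus_left fun_upd_apply)
      \<comment> \<open>For \<open>j\<close> in \<open>I\<close> this is inherited from
        \<open>C\<close>; at \<open>i\<close> it is the condition on the sum over
        \<open>I\<close>.\<close>
      moreover have "\<not> P dvd D j" if "j \<in> ?J" for j
        using C assms that by (auto simp: Y_def admissible_def dvd_mod_iff
            simp del: poly_mod_minus_left)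
      ultimately show "D \<in> Z" by (simp add: Z_def U)
    qed
    moreover have "?g ` Z \<subseteq> Y"
    proof
      fix D assume "D \<in> ?g ` Z"
      then obtain C where C: "C \<in> Z" "D = ?g C" by auto
      then have "D \<in> I \<rightarrow>\<^sub>E reduced P" by (auto simp: Z_def U PiE_iff)
      \<comment> \<open>\<open>P\<close> divides the total but not the entry at \<open>i\<close>,
        hence not the sum of the other entries.\<close>
      moreover have "\<not> P dvd (\<Sum>j\<in>I. C j)"
        using C assms by (auto simp: Z_def U dvd_add_left_iff)
      ultimately show "D \<in> Y" using C by (auto simp: Y_def Z_def U admissible_def)
    qed
    ultimately have "bij_betw ?f Y Z" by (rule bij_betw_byWitness)
    then show ?thesis by (rule bij_betw_same_card)
  qed
  ultimately show ?thesis by (simp add: X_def Y_def)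
qed

text \<open>The alternating sum is the solution of the recurrence in
  \<open>card_admissible_insert\<close>, with the power of \<open>poly_abs P - 1\<close> factored
  out.\<close>

lemma card_admissible:
  assumes "irreducible P" "finite I"
  shows "real (card {C \<in> I \<rightarrow>\<^sub>E reduced P. admissible I P C}) =
    (poly_abs P - 1) ^ card I * (\<Sum>j<card I. (-1) ^ j * (1 / (poly_abs P - 1) ^ j))"
  using assms(2)
proof (induction I rule: finite_induct)
  case empty
  \<comment> \<open>The empty tuple has sum 0, which \<open>P\<close> divides, so the count is 0, as
    is the empty alternating sum.\<close>
  then show ?case by (simp add: admissible_def)
next
  case (insert i I)
  let ?m = "poly_abs P - 1"
  have P: "P \<noteq> 0" and m: "?m > 0"
    using assms poly_abs_irreducible_gt_1[of P] by auto
  have "real (card (reduced P) - 1) = ?m"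
    using P m card_reduced[of P] by (simp add: of_nat_diff)
  then have "real (card {C \<in> insert i I \<rightarrow>\<^sub>E reduced P. admissible (insert i I) P C}) =
      ?m ^ Suc (card I) - real (card {C \<in> I \<rightarrow>\<^sub>E reduced P. admissible I P C})"
    using arg_cong[OF card_admissible_insert[OF P insert.hyps], of real] by simp
  also have "\<dots> = ?m ^ Suc (card I) *
      (1 - (1 / ?m) * (\<Sum>j<card I. (-1) ^ j * (1 / ?m ^ j)))"
    using m by (simp add: insert.IH right_diff_distrib)
  \<comment> \<open>Multiplication by \<open>- (1 / ?m)\<close> shifts the index of the alternating
    sum by one, and the leading 1 is the new term at \<open>j = 0\<close>.\<close>
  also have "1 - (1 / ?m) * (\<Sum>j<card I. (-1) ^ j * (1 / ?m ^ j)) =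
      (\<Sum>j<Suc (card I). (-1) ^ j * (1 / ?m ^ j))"
    by (simp add: sum.lessThan_Suc_shift sum_distrib_left sum_negf
        del: sum.lessThan_Suc)
  finally show ?case using insert.hyps by simp
qed

section \<open>Lifting tuples from \<open>H\<close> to \<open>P * H\<close>\<close>

definition admissible_tuples :: "nat set \<Rightarrow> 'a::{finite,field} poly \<Rightarrow> (nat \<Rightarrow> 'a poly) set" where
  "admissible_tuples I H =
    {A \<in> I \<rightarrow>\<^sub>E reduced H. \<forall>P\<in>monic_prime_divisors H. admissible I P A}"

lemma finite_admissible_tuples: "finite I \<Longrightarrow> finite (admissible_tuples I H)"
  by (simp add: admissible_tuples_def finite_PiE)

text \<open>Injectivity is uniqueness of the remainder modulo \<open>H\<close>, entry by entry.
  Surjectivity then follows by counting, since \<open>poly_abs\<close> is multiplicative.\<close>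

lemma bij_betw_lift_tuples:
  assumes "H \<noteq> 0" "P \<noteq> 0" "finite I"
  shows "bij_betw (\<lambda>(B, C). \<lambda>i\<in>I. B i + H * C i)
    ((I \<rightarrow>\<^sub>E reduced H) \<times> (I \<rightarrow>\<^sub>E reduced P)) (I \<rightarrow>\<^sub>E reduced (P * H))"
    (is "bij_betw ?f ?X ?Y")
proof -
  have "inj_on ?f ?X"
  proof (rule inj_onI, clarify)
    fix B C B' C'
    assume BC: "B \<in> I \<rightarrow>\<^sub>E reduced H" "C \<in> I \<rightarrow>\<^sub>E reduced P"
        "B' \<in> I \<rightarrow>\<^sub>E reduced H" "C' \<in> I \<rightarrow>\<^sub>E reduced P"
      and eq: "(\<lambda>i\<in>I. B i + H * C i) = (\<lambda>i\<in>I. B' i + H * C' i)"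
    have "B i = B' i \<and> C i = C' i" if "i \<in> I" for i
    proof -
      have e: "B i + H * C i = B' i + H * C' i" using fun_cong[OF eq, of i] that by simp
      then have "B i - B' i = H * (C' i - C i)" by (simp add: algebra_simps)
      then have "B i = B' i" using BC that by (intro reduced_cong_imp_eq[of _ H]) auto
      then show ?thesis using e assms by simp
    qed
    then show "B = B' \<and> C = C'"
      using PiE_ext[OF BC(1,3)] PiE_ext[OF BC(2,4)] by blast
  qed
  moreover have "?f ` ?X \<subseteq> ?Y"
    using assms by (auto intro!: add_mult_in_reduced)
  moreover have "real (card ?X) = real (card ?Y)"
    using assms card_reduced[of H] card_reduced[of P] card_reduced[of "P * H"]
    by (simp add: card_cartesian_product card_PiE poly_abs_mult power_mult_distrib)
  moreover have "finite ?Y" using assms by (simp add: finite_PiE)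
  ultimately have "?f ` ?X = ?Y" by (intro card_subset_eq) (simp_all add: card_image)
  with \<open>inj_on ?f ?X\<close> show ?thesis by (simp add: bij_betw_def)
qed

text \<open>Since \<open>H\<close> is invertible modulo the prime \<open>P\<close>, the affine map
  is injective on reduced tuples and therefore permutes this finite set. Admissibility depends only
  on residues modulo \<open>P\<close>, so the permutation carries one set onto the other.\<close>

lemma card_admissible_affine:
  assumes "prime_elem P" "\<not> P dvd H" "finite I"
  shows "card {C \<in> I \<rightarrow>\<^sub>E reduced P. admissible I P (\<lambda>i. B i + H * C i)} =
    card {C \<in> I \<rightarrow>\<^sub>E reduced P. admissible I P C}"
proof -
  let ?S = "I \<rightarrow>\<^sub>E reduced P"
  let ?f = "\<lambda>C. \<lambda>i\<in>I. (B i + H * C i) mod P"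
  have P: "P \<noteq> 0" using assms by auto
  have "inj_on ?f ?S"
  proof (rule inj_onI)
    fix C D assume CD: "C \<in> ?S" "D \<in> ?S" and eq: "?f C = ?f D"
    have "C i = D i" if "i \<in> I" for i
    proof -
      have "(B i + H * C i) mod P = (B i + H * D i) mod P"
        using fun_cong[OF eq, of i] that by simp
      then have "P dvd H * (C i - D i)" by (simp add: mod_eq_dvd_iff algebra_simps)
      then have "P dvd C i - D i" using assms by (simp add: prime_elem_dvd_mult_iff)
      then show ?thesis using CD that by (intro reduced_cong_imp_eq[of _ P]) auto
    qed
    then show "C = D" by (rule PiE_ext[OF CD])
  qed
  moreover have "?f ` ?S \<subseteq> ?S" using P by (auto simp: mod_in_reduced)
  moreover have "finite ?S" using assms by (simp add: finite_PiE)
  ultimately have surj: "?f ` ?S = ?S" by (simp add: endo_inj_surj)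
  have adm: "admissible I P (?f C) \<longleftrightarrow> admissible I P (\<lambda>i. B i + H * C i)" for C
    by (rule admissible_cong) (simp add: cong_def)
  have "{C \<in> ?S. admissible I P C} = ?f ` {C \<in> ?S. admissible I P (\<lambda>i. B i + H * C i)}"
    (is "?L = ?f ` ?R")
  proof
    show "?L \<subseteq> ?f ` ?R"
    proof
      fix D assume "D \<in> ?L"
      then obtain C where "C \<in> ?S" "D = ?f C" using surj by blast
      then show "D \<in> ?f ` ?R" using adm \<open>D \<in> ?L\<close> by blast
    qed
    show "?f ` ?R \<subseteq> ?L" using adm surj by blast
  qed
  moreover have "inj_on ?f ?R" using \<open>inj_on ?f ?S\<close> by (rule inj_on_subset) auto
  ultimately show ?thesis by (simp add: card_image)
qed

text \<open>A repeated prime adds no condition, so every \<open>C\<close> is allowed over an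
  admissible \<open>B\<close>. A new prime restricts \<open>C\<close>, but by
  \<open>card_admissible_affine\<close> the number of allowed \<open>C\<close> is the same for every
  \<open>B\<close>.\<close>

lemma card_admissible_tuples_mult:
  assumes "H \<noteq> 0" "lead_coeff P = 1" "irreducible P" "finite I"
  shows "card (admissible_tuples I (P * H)) = card (admissible_tuples I H) *
    (if P dvd H then card (reduced P) ^ card I
     else card {C \<in> I \<rightarrow>\<^sub>E reduced P. admissible I P C})"
proof -
  let ?S = "I \<rightarrow>\<^sub>E reduced P"
  let ?f = "\<lambda>(B, C). \<lambda>i\<in>I. B i + H * C i"
  have P: "P \<noteq> 0" using assms by auto
  \<comment> \<open>\<open>N B\<close> is the fibre over \<open>B\<close>; the disjunct
    \<open>P dvd H\<close> removes the condition at \<open>P\<close> when \<open>B\<close> already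
    satisfies it.\<close>
  define N where "N = (\<lambda>B. {C \<in> ?S. P dvd H \<or> admissible I P (\<lambda>i. B i + H * C i)})"
  have bij: "bij_betw ?f ((I \<rightarrow>\<^sub>E reduced H) \<times> ?S) (I \<rightarrow>\<^sub>E reduced (P * H))"
    using assms P by (intro bij_betw_lift_tuples)
  have adm: "admissible I Q (?f (B, C)) \<longleftrightarrow> admissible I Q (\<lambda>i. B i + H * C i)" for Q B C
    by (rule admissible_cong) simp
  have adm_dvd: "admissible I Q (\<lambda>i. B i + H * C i) \<longleftrightarrow> admissible I Q B" if "Q dvd H" for Q B C
    using that by (intro admissible_cong) (simp add: cong_iff_dvd_diff)
  have mem: "?f (B, C) \<in> admissible_tuples I (P * H) \<longleftrightarrow> B \<in> admissible_tuples I H \<and> C \<in> N B"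
    if "B \<in> I \<rightarrow>\<^sub>E reduced H" "C \<in> ?S" for B C
  proof -
    have "?f (B, C) \<in> I \<rightarrow>\<^sub>E reduced (P * H)"
      using that bij by (blast dest: bij_betwE)
    moreover have "admissible I Q (\<lambda>i. B i + H * C i) \<longleftrightarrow> admissible I Q B"
      if "Q \<in> monic_prime_divisors H" for Q
      using that by (intro adm_dvd) (simp add: monic_prime_divisors_def)
    moreover have "P dvd H \<longleftrightarrow> P \<in> monic_prime_divisors H"
      using assms by (simp add: monic_prime_divisors_def)
    ultimately show ?thesis
      using that assms unfolding admissible_tuples_def mem_Collect_eq adm N_def
      by (auto simp: monic_prime_divisors_mult)
  qed
  have "admissible_tuples I (P * H) = ?f ` (SIGMA B:admissible_tuples I H. N B)"
  proof
    show "admissible_tuples I (P * H) \<subseteq> ?f ` (SIGMA B:admissible_tuples I H. N B)"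
    proof
      fix A assume A: "A \<in> admissible_tuples I (P * H)"
      then have "A \<in> I \<rightarrow>\<^sub>E reduced (P * H)" by (simp add: admissible_tuples_def)
      then have "A \<in> ?f ` ((I \<rightarrow>\<^sub>E reduced H) \<times> ?S)"
        using bij_betw_imp_surj_on[OF bij] by blast
      then obtain B C where "B \<in> I \<rightarrow>\<^sub>E reduced H" "C \<in> ?S" "A = ?f (B, C)"
        by blast
      then show "A \<in> ?f ` (SIGMA B:admissible_tuples I H. N B)"
        using A mem by blast
    qed
    show "?f ` (SIGMA B:admissible_tuples I H. N B) \<subseteq> admissible_tuples I (P * H)"
    proof
      fix A assume "A \<in> ?f ` (SIGMA B:admissible_tuples I H. N B)"
      then obtain B C where BC: "B \<in> admissible_tuples I H" "C \<in> N B" "A = ?f (B, C)" by blast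
      then have "B \<in> I \<rightarrow>\<^sub>E reduced H" "C \<in> ?S" by (auto simp: admissible_tuples_def N_def)
      then show "A \<in> admissible_tuples I (P * H)" using mem BC by blast
    qed
  qed
  moreover have "inj_on ?f (SIGMA B:admissible_tuples I H. N B)"
    using bij by (elim inj_on_subset[OF bij_betw_imp_inj_on]) (auto simp: admissible_tuples_def N_def)
  ultimately have "card (admissible_tuples I (P * H)) = card (SIGMA B:admissible_tuples I H. N B)"
    by (simp add: card_image)
  also have "\<dots> = (\<Sum>B\<in>admissible_tuples I H. card (N B))"
    using assms by (intro card_SigmaI) (auto simp: finite_admissible_tuples N_def finite_PiE)
  also have "\<dots> = (\<Sum>B\<in>admissible_tuples I H. if P dvd H then card (reduced P) ^ card I
     else card {C \<in> ?S. admissible I P C})"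
    using assms card_admissible_affine[OF field_poly_irreducible_imp_prime, of P H I]
    by (intro sum.cong) (simp_all add: N_def card_PiE)
  finally show ?thesis by simp
qed

text \<open>Each factor \<open>P\<close> changes both sides alike. A repeated one multiplies
  \<open>euler_phi\<close> by \<open>poly_abs P\<close> and keeps the set of primes; a new one
  multiplies \<open>euler_phi\<close> by \<open>poly_abs P - 1\<close> and adds the alternating sum
  from \<open>card_admissible\<close>.\<close>

lemma card_admissible_tuples:
  assumes "H \<noteq> 0" "finite I"
  shows "real (card (admissible_tuples I H)) = euler_phi H ^ card I *
    (\<Prod>P\<in>monic_prime_divisors H. \<Sum>j<card I. (-1) ^ j * (1 / (poly_abs P - 1) ^ j))"
  using assms(1)
proof (induction H rule: poly_divisor_induct)
  case (unit H)
  then have "H \<noteq> 0" by auto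
  then have "degree H = 0" using unit is_unit_iff_degree[of H] by blast
  \<comment> \<open>Modulo a unit the zero tuple is the only one, and no prime excludes it; on the
    right \<open>euler_phi H\<close> and the empty product are 1.\<close>
  then have "reduced H = {0}"
    by (auto simp: reduced_def poly_eq_iff)
  then have "admissible_tuples I H = I \<rightarrow>\<^sub>E {0}"
    using unit by (simp add: admissible_tuples_def monic_prime_divisors_unit)
  then show ?case
    using assms unit \<open>H \<noteq> 0\<close> \<open>degree H = 0\<close>
    by (simp add: monic_prime_divisors_unit euler_phi_def poly_abs_def card_PiE)
next
  case (mult P H)
  let ?n = "card I"
  let ?s = "\<lambda>P. \<Sum>j<?n. (-1) ^ j * (1 / (poly_abs P - 1) ^ j)"
  have P: "P \<noteq> 0" "poly_abs P > 1"
    using mult poly_abs_irreducible_gt_1[of P] by auto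
  note fin = finite_monic_prime_divisors[OF \<open>H \<noteq> 0\<close>]
  show ?case
  proof (cases "P dvd H")
    case True
    then have "monic_prime_divisors (P * H) = monic_prime_divisors H"
      using mult by (auto simp: monic_prime_divisors_mult monic_prime_divisors_def[of H])
    then show ?thesis
      using True mult assms P card_reduced[of P]
      by (simp add: card_admissible_tuples_mult euler_phi_def poly_abs_mult power_mult_distrib)
  next
    case False
    then have new: "P \<notin> monic_prime_divisors H" by (simp add: monic_prime_divisors_def)
    have "euler_phi (P * H) = (poly_abs P - 1) * euler_phi H"
      using mult new fin P
      by (simp add: euler_phi_def monic_prime_divisors_mult poly_abs_mult) (simp add: field_simps)
    then show ?thesis
      using False mult new fin assms
      by (simp add: card_admissible_tuples_mult card_admissible monic_prime_divisors_mult
          power_mult_distrib)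
  qed
qed

section \<open>From reduced representatives to residue classes\<close>

lemma bij_betw_residue_classes:
  assumes "H \<noteq> 0"
  shows "bij_betw (\<lambda>A. {X. [A = X] (mod H)}) (reduced H) (residue_classes H)"
proof (rule bij_betwI')
  fix A B assume AB: "A \<in> reduced H" "B \<in> reduced H"
  show "{X. [A = X] (mod H)} = {X. [B = X] (mod H)} \<longleftrightarrow> A = B"
  proof
    assume "{X. [A = X] (mod H)} = {X. [B = X] (mod H)}"
    then have "[B = A] (mod H)" by auto
    then show "A = B" using AB by (metis cong_def reduced_mod_eq)
  qed simp
next
  fix A show "{X. [A = X] (mod H)} \<in> residue_classes H"
    by (auto simp: residue_classes_def quotient_def)
next
  fix C assume "C \<in> residue_classes H"
  then obtain R where "C = {X. [R = X] (mod H)}"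
    by (auto simp: residue_classes_def quotient_def)
  then have "C = {X. [R mod H = X] (mod H)}" by (simp add: cong_def)
  then show "\<exists>A\<in>reduced H. C = {X. [A = X] (mod H)}"
    using mod_in_reduced[OF assms] by blast
qed

text \<open>A prime divides the product exactly when it divides some entry, so both coprimality
  conditions can be tested prime by prime.\<close>

lemma coprime_prod_sum_iff_admissible:
  assumes "H \<noteq> 0" "finite I"
  shows "coprime (\<Prod>i\<in>I. A i) H \<and> coprime (\<Sum>i\<in>I. A i) H \<longleftrightarrow>
    (\<forall>P\<in>monic_prime_divisors H. admissible I P A)"
proof -
  have "P dvd (\<Prod>i\<in>I. A i) \<longleftrightarrow> (\<exists>i\<in>I. P dvd A i)" if "P \<in> monic_prime_divisors H" for P
  proof -
    have "prime_elem P"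
      using that by (auto simp: monic_prime_divisors_def intro: field_poly_irreducible_imp_prime)
    from assms(2) show ?thesis
      by (induction I rule: finite_induct)
        (use \<open>prime_elem P\<close> in \<open>auto simp: prime_elem_dvd_mult_iff prime_elem_not_unit\<close>)
  qed
  then show ?thesis
    using assms by (auto simp: coprime_iff_monic_prime_divisors admissible_def)
qed

lemma generalized_phi_eq_card_admissible_tuples:
  assumes "H \<noteq> 0"
  shows "generalized_phi k H = card (admissible_tuples {1..k} H)"
proof -
  let ?I = "{1..k}"
  let ?r = "\<lambda>A. {X. [A = X] (mod H)}"
  let ?f = "\<lambda>A. \<lambda>i\<in>?I. ?r (A i)"
  let ?good = "\<lambda>A. coprime (\<Prod>i=1..k. A i) H \<and> coprime (\<Sum>i=1..k. A i) H"
  let ?G = "{C \<in> ?I \<rightarrow>\<^sub>E residue_classes H. \<exists>A. (\<forall>i\<in>?I. A i \<in> C i) \<and> ?good A}"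
  note bij = bij_betw_residue_classes[OF assms]
  have inj: "inj_on ?f (?I \<rightarrow>\<^sub>E reduced H)"
  proof (rule inj_onI)
    fix A B assume AB: "A \<in> ?I \<rightarrow>\<^sub>E reduced H" "B \<in> ?I \<rightarrow>\<^sub>E reduced H" "?f A = ?f B"
    have "A i = B i" if "i \<in> ?I" for i
    proof -
      have "?r (A i) = ?r (B i)" using fun_cong[OF AB(3), of i] that by simp
      then show ?thesis
        using PiE_mem[OF AB(1) that] PiE_mem[OF AB(2) that]
        by (rule inj_onD[OF bij_betw_imp_inj_on[OF bij]])
    qed
    then show "A = B" by (rule PiE_ext[OF AB(1,2)])
  qed
  have f_mem: "?f A \<in> ?I \<rightarrow>\<^sub>E residue_classes H" if "A \<in> ?I \<rightarrow>\<^sub>E reduced H" for A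
    by (auto simp: residue_classes_def quotient_def)
  \<comment> \<open>Membership in \<open>?G\<close> allows any representatives; by
    \<open>generalized_phi_representatives\<close> the conditions may be tested on \<open>A\<close>
    itself.\<close>
  have good: "?f A \<in> ?G \<longleftrightarrow> ?good A" if "A \<in> ?I \<rightarrow>\<^sub>E reduced H" for A
  proof -
    have "\<forall>i\<in>?I. A i \<in> ?f A i" by simp
    then show ?thesis
      using f_mem[OF that] generalized_phi_representatives[OF f_mem[OF that]] by blast
  qed
  have "?G = ?f ` admissible_tuples ?I H"
  proof
    show "?G \<subseteq> ?f ` admissible_tuples ?I H"
    proof
      fix C assume C: "C \<in> ?G"
      \<comment> \<open>The reduced representative of each class, restricted to the index set so
        that \<open>A\<close> is extensional.\<close>
      define A where "A = (\<lambda>i\<in>?I. inv_into (reduced H) ?r (C i))"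
      have C_mem: "C i \<in> ?r ` reduced H" if "i \<in> ?I" for i
        using C that bij by (auto simp: bij_betw_def)
      have A: "A \<in> ?I \<rightarrow>\<^sub>E reduced H"
        using C_mem by (auto simp: A_def intro!: inv_into_into)
      have "C = ?f A"
      proof
        fix i show "C i = ?f A i"
        proof (cases "i \<in> ?I")
          case True
          then show ?thesis using f_inv_into_f[OF C_mem[OF True]] by (simp add: A_def)
        next
          case False
          then show ?thesis using C by (auto simp: PiE_iff extensional_def)
        qed
      qed
      moreover have "A \<in> admissible_tuples ?I H"
        using C A good[OF A] assms unfolding \<open>C = ?f A\<close> admissible_tuples_def
        by (simp add: coprime_prod_sum_iff_admissible)
      ultimately show "C \<in> ?f ` admissible_tuples ?I H" by blast
    qed
    show "?f ` admissible_tuples ?I H \<subseteq> ?G"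
    proof
      fix C assume "C \<in> ?f ` admissible_tuples ?I H"
      then obtain A where A: "A \<in> admissible_tuples ?I H" "C = ?f A" by blast
      then have "A \<in> ?I \<rightarrow>\<^sub>E reduced H" "?good A"
        using assms by (simp_all add: admissible_tuples_def coprime_prod_sum_iff_admissible)
      then show "C \<in> ?G" using good A(2) by blast
    qed
  qed
  moreover have "inj_on ?f (admissible_tuples ?I H)"
    using inj by (rule inj_on_subset) (auto simp: admissible_tuples_def)
  ultimately show ?thesis
    unfolding generalized_phi_def by (simp only: card_image)
qed

theorem theorem1p1:
  fixes H :: "'a::{finite,field} poly" and k :: nat
  assumes "H \<noteq> 0" and "k \<ge> 1"
  shows "real (generalized_phi k H) =
    euler_phi H ^ k *
    (\<Prod>P\<in>monic_prime_divisors H. \<Sum>j=0..k-1. (-1) ^ j * (1 / (poly_abs P - 1) ^ j))"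
proof -
  \<comment> \<open>Here \<open>k\<close> must be positive: for \<open>k = 0\<close> truncated
    subtraction would make the left side \<open>{0}\<close> and the right side is empty.\<close>
  have "{0..k-1} = {..<k}" using assms by auto
  then show ?thesis
    using assms card_admissible_tuples[of H "{1..k}"]
    by (simp add: generalized_phi_eq_card_admissible_tuples)
qed

end
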